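(* Let $s$ and $t$ be integers with $1\leq s\leq t-1$, and let $p\in(0,1)$. Then $$\gamma^{\frac{s}{t}}(G(n,p))\in\left[\lfloor a_{p}(n)\rfloor_{t}+\frac{1}{t},\ b_{p,t}(n)\right]$$ with probability tending to $1$ as $n\to\infty$.
   Context: For a graph $G$ and $u\in V(G)$, $N_G(u)$ is the set of neighbours of $u$. For $c\in\mathbb{R}^{+}\cup\{\infty\}$, a function $f:V(G)\to\mathbb{R}^{+}\cup\{0,\infty\}$ is a $c$-self dominating function ($c$-SDF) of $G$ if for every $u\in V(G)$, $f(u)\geq c$ or $\max\{f(v):v\in N_G(u)\}\geq 1$. The weight is $w(f)=\sum_{u\in V(G)}f(u)$, and $\gamma^{c}(G)$ is the minimum weight of a $c$-SDF of $G$. $G(n,p)$ is the Erdős–Rényi random graph on $\{1,\dots,n\}$ with each edge present independently with probability $p$. For $p\in(0,1)$ and integers $n\geq 2$, $a_{p}(n)=\log_{1/(1-p)}\frac{n}{\log_{1/(1-p)}n\cdot\ln n}$. For $t\in\mathbb{Z}^{+}$ and $a\in\mathbb{R}$, $\lfloor a\rfloor_{t}$ is the largest number in $\{m_1+\frac{m_2}{t}: m_1,m_2\in\mathbb{Z},\ m_1+\frac{m_2}{t}\leq a\}$, and $b_{p,t}(n)=\left\lfloor \lfloor a_{p}(n)\rfloor_{t}+\frac{1}{t}\right\rfloor+1$. *)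

theory Defs
  imports "HOL-Probability.Probability"
begin

text \<open>A graph is a pair of a vertex set and a set of edges, each edge being a two-element set
  of vertices.\<close>

type_synonym 'a graph = "'a set \<times> 'a set set"

definition verts :: "'a graph \<Rightarrow> 'a set" where
  "verts G = fst G"

definition edges :: "'a graph \<Rightarrow> 'a set set" where
  "edges G = snd G"

definition nbhd :: "'a graph \<Rightarrow> 'a \<Rightarrow> 'a set" where
  "nbhd G u = {v \<in> verts G. {u, v} \<in> edges G}"

text \<open>Only the values of \<open>f\<close> on the vertex set matter. The conjunct \<open>nbhd G u \<noteq> {}\<close> makes the
  condition on the maximum false at an isolated vertex, since \<open>Max {}\<close> is unspecified; an
  isolated vertex thus needs \<open>f u \<ge> c\<close>.\<close>

definition self_dominating :: "ennreal \<Rightarrow> 'a graph \<Rightarrow> ('a \<Rightarrow> ennreal) \<Rightarrow> bool" where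
  "self_dominating c G f \<longleftrightarrow>
     (\<forall>u \<in> verts G. f u \<ge> c \<or> (nbhd G u \<noteq> {} \<and> Max {f v | v. v \<in> nbhd G u} \<ge> 1))"

definition weight :: "'a graph \<Rightarrow> ('a \<Rightarrow> ennreal) \<Rightarrow> ennreal" where
  "weight G f = (\<Sum>u \<in> verts G. f u)"

text \<open>The infimum is a minimum for every finite graph: see \<open>sd_number_attained\<close> below.\<close>

definition sd_number :: "ennreal \<Rightarrow> 'a graph \<Rightarrow> ennreal" where
  "sd_number c G = Inf {weight G f | f. self_dominating c G f}"

lemma self_dominating_alt:
  assumes "finite (verts G)"
  shows "self_dominating c G f \<longleftrightarrow> (\<forall>u \<in> verts G. f u \<ge> c \<or> (\<exists>v \<in> nbhd G u. f v \<ge> 1))"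
proof -
  have "(nbhd G u \<noteq> {} \<and> Max {f v | v. v \<in> nbhd G u} \<ge> 1) \<longleftrightarrow> (\<exists>v \<in> nbhd G u. f v \<ge> 1)" for u
  proof -
    have "finite (nbhd G u)"
      using assms by (simp add: nbhd_def)
    moreover have "{f v | v. v \<in> nbhd G u} = f ` nbhd G u"
      by auto
    ultimately show ?thesis
      by (cases "nbhd G u = {}") (auto simp: Max_ge_iff)
  qed
  then show ?thesis
    unfolding self_dominating_def by blast
qed

lemma sd_number_attained:
  assumes fin: "finite (verts G)"
  shows "\<exists>f. self_dominating c G f \<and> weight G f = sd_number c G"
proof -
  define W where "W = {weight G f | f. self_dominating c G f}"
  define F where "F = {f. self_dominating c G f \<and> (\<forall>u \<in> verts G. f u \<in> {0, c, 1})}"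
  have red: "\<exists>g \<in> F. weight G g \<le> weight G f" if f: "self_dominating c G f" for f
  proof -
    define g where "g = (\<lambda>u. if f u \<ge> max c 1 then max c 1 else if f u \<ge> min c 1 then min c 1 else 0)"
    have "g u \<ge> c \<longleftrightarrow> f u \<ge> c" and "g u \<ge> 1 \<longleftrightarrow> f u \<ge> 1" if "c > 0" for u
      using that by (auto simp: g_def max_def min_def not_le)
    moreover have "g u \<ge> c" if "c = 0" for u
      using that by simp
    ultimately have "self_dominating c G g"
      using f unfolding self_dominating_alt[OF fin] by (cases "c = 0") (auto simp: zero_less_iff_neq_zero)
    moreover have "g u \<in> {0, c, 1}" for u
      by (auto simp: g_def max_def min_def)
    moreover have "g u \<le> f u" for u
      by (auto simp: g_def)
    ultimately show ?thesis
      unfolding weight_def F_def by (intro bexI[of _ g]) (auto intro: sum_mono)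
  qed
  have finF: "finite (weight G ` F)"
  proof (rule finite_subset)
    show "weight G ` F \<subseteq> weight G ` (verts G \<rightarrow>\<^sub>E {0, c, 1})"
    proof
      fix w assume "w \<in> weight G ` F"
      then obtain f where f: "f \<in> F" "w = weight G f" by blast
      then have "w = weight G (restrict f (verts G))"
        by (simp add: weight_def)
      moreover have "restrict f (verts G) \<in> verts G \<rightarrow>\<^sub>E {0, c, 1}"
        using f by (auto simp: F_def)
      ultimately show "w \<in> weight G ` (verts G \<rightarrow>\<^sub>E {0, c, 1})" by blast
    qed
    show "finite (weight G ` (verts G \<rightarrow>\<^sub>E {0, c, 1}))"
      using fin by (intro finite_imageI finite_PiE) auto
  qed
  have "self_dominating c G (\<lambda>_. c)"
    by (simp add: self_dominating_def)
  then have ne: "weight G ` F \<noteq> {}"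
    using red by blast
  define m where "m = Min (weight G ` F)"
  have "m \<in> weight G ` F"
    using finF ne by (simp add: m_def)
  then obtain f where f: "f \<in> F" "weight G f = m" by blast
  have "Inf W = m"
  proof (rule antisym)
    show "Inf W \<le> m"
      using f by (intro Inf_lower) (auto simp: W_def F_def)
    show "m \<le> Inf W"
    proof (rule Inf_greatest)
      fix w assume "w \<in> W"
      then obtain h where "w = weight G h" "self_dominating c G h"
        by (auto simp: W_def)
      then obtain g where "g \<in> F" "weight G g \<le> w"
        using red by blast
      moreover from this have "m \<le> weight G g"
        using finF by (simp add: m_def)
      ultimately show "m \<le> w" by simp
    qed
  qed
  then show ?thesis
    using f unfolding sd_number_def W_def F_def by auto
qed

definition vertex_pairs :: "nat \<Rightarrow> nat set set" where
  "vertex_pairs n = {e. e \<subseteq> {1..n} \<and> card e = 2}"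

definition random_graph :: "nat \<Rightarrow> real \<Rightarrow> nat graph pmf" where
  "random_graph n p =
     map_pmf (\<lambda>X. ({1..n}, {e \<in> vertex_pairs n. X e}))
       (Pi_pmf (vertex_pairs n) False (\<lambda>_. bernoulli_pmf p))"

definition a_val :: "real \<Rightarrow> nat \<Rightarrow> real" where
  "a_val p n = log (1 / (1 - p)) (real n / (log (1 / (1 - p)) (real n) * ln (real n)))"

definition floor_frac :: "int \<Rightarrow> real \<Rightarrow> real" where
  "floor_frac t a =
     (GREATEST x. x \<in> {of_int m1 + of_int m2 / of_int t | m1 m2 :: int.
                         of_int m1 + of_int m2 / of_int t \<le> a})"

lemma floor_frac_altdef:
  assumes "t > 0"
  shows "floor_frac t a = of_int \<lfloor>of_int t * a\<rfloor> / of_int t"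
  unfolding floor_frac_def
proof (rule Greatest_equality)
  show "of_int \<lfloor>of_int t * a\<rfloor> / of_int t \<in> {of_int m1 + of_int m2 / of_int t | m1 m2 :: int.
                         of_int m1 + of_int m2 / of_int t \<le> a}"
    using assms by (intro CollectI exI[of _ 0] exI[of _ "\<lfloor>of_int t * a\<rfloor>"])
      (auto simp: divide_le_eq mult.commute)
next
  fix y :: real assume "y \<in> {of_int m1 + of_int m2 / of_int t | m1 m2 :: int.
                         of_int m1 + of_int m2 / of_int t \<le> a}"
  then obtain m1 m2 :: int where y: "y = of_int m1 + of_int m2 / of_int t" "y \<le> a" by blast
  have eq: "y = of_int (m1 * t + m2) / of_int t"
    using assms y(1) by (simp add: field_simps)
  then have "of_int (m1 * t + m2) \<le> of_int t * a"
    using y(2) assms by (simp add: divide_le_eq mult.commute)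
  then have "m1 * t + m2 \<le> \<lfloor>of_int t * a\<rfloor>"
    by (simp only: le_floor_iff)
  then show "y \<le> of_int \<lfloor>of_int t * a\<rfloor> / of_int t"
    unfolding eq using assms by (intro divide_right_mono) (simp_all only: of_int_le_iff of_int_0_le_iff)
qed

definition b_val :: "real \<Rightarrow> int \<Rightarrow> nat \<Rightarrow> int" where
  "b_val p t n = \<lfloor>floor_frac t (a_val p n) + 1 / of_int t\<rfloor> + 1"

end

theory Submission imports Defs "HOL-Real_Asymp.Real_Asymp" begin

text \<open>
  Put \<open>q = 1 - p\<close> and \<open>\<lambda> = log\<^bsub>1/q\<^esub> n \<cdot> ln n\<close>, so that \<open>q powr a_val p n = \<lambda> / n\<close>.

  Lower bound: a self-dominating function \<open>f\<close> yields the disjoint sets \<open>A = {f \<ge> 1}\<close> and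
  \<open>B = {s/t \<le> f < 1}\<close> such that \<open>A\<close> dominates every vertex outside \<open>A \<union> B\<close>, and its weight is at
  least \<open>|A| + (s/t)|B|\<close>, a multiple of \<open>1/t\<close>. By the first moment method, with high probability no such
  pair has \<open>|A| + (s/t)|B| \<le> a_val p n\<close>: trading a unit of weight in \<open>A\<close> for \<open>t/s\<close> elements of \<open>B\<close>
  gains only a factor polynomial in \<open>n\<close> in the number of pairs, but multiplies \<open>q ^ |A|\<close> by a constant
  and so costs a factor \<open>exp (- const \<cdot> \<lambda>)\<close> in probability.

  Upper bound: \<open>b_val p t n\<close> exceeds \<open>a_val p n\<close> by at least \<open>1/t\<close>, which suffices for the second moment
  method to produce a dominating set with exactly \<open>b_val p t n\<close> elements. The correlation of two candidate
  sets meeting in \<open>m\<close> points is log-convex in \<open>m\<close>, so only \<open>m = 0\<close>, \<open>m = 1\<close> and equal sets matter.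
\<close>

subsection \<open>Domination in the random graph\<close>

text \<open>Intersecting both sets with the supports makes them countable without changing any
  probability, and for countable sets the product formula applies.\<close>

lemma prob_pair_pmf_Times:
  "measure_pmf.prob (pair_pmf P Q) (A \<times> B) = measure_pmf.prob P A * measure_pmf.prob Q B"
proof -
  have "measure_pmf.prob (pair_pmf P Q) (A \<times> B) =
      measure_pmf.prob (pair_pmf P Q) ((A \<inter> set_pmf P) \<times> (B \<inter> set_pmf Q))"
    by (subst (1 2) measure_Int_set_pmf[symmetric]) (rule arg_cong[where f = "measure_pmf.prob _"], auto)
  also have "\<dots> = measure_pmf.prob P A * measure_pmf.prob Q B"
    by (subst measure_pmf_prob_product) (auto simp: measure_Int_set_pmf countable_set_pmf intro: countable_Int2)
  finally show ?thesis .
qed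

text \<open>Splitting the coordinates into \<open>J\<close> and \<open>I - J\<close> turns the
  product into a pair of independent factors. The conditions on \<open>Q\<close> and
  \<open>R\<close> say that they look only at the first or only at the second factor, so the joint
  event is a rectangle.\<close>

lemma prob_Pi_pmf_indep:
  assumes I: "finite I" and J: "J \<subseteq> I"
    and Q: "\<And>X Y. (\<And>i. i \<in> J \<Longrightarrow> X i = Y i) \<Longrightarrow> Q X \<longleftrightarrow> Q Y"
    and R: "\<And>X Y. (\<And>i. i \<in> I - J \<Longrightarrow> X i = Y i) \<Longrightarrow> R X \<longleftrightarrow> R Y"
  shows "measure_pmf.prob (Pi_pmf I d D) {X. Q X \<and> R X} =
    measure_pmf.prob (Pi_pmf I d D) {X. Q X} * measure_pmf.prob (Pi_pmf I d D) {X. R X}"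
proof -
  define h where "h = (\<lambda>(f, g) x. if x \<in> J then f x else g x :: 'b)"
  define M where "M = pair_pmf (Pi_pmf J d D) (Pi_pmf (I - J) d D)"
  have eq: "Pi_pmf I d D = map_pmf h M"
    using Pi_pmf_union[of J "I - J" d D] I J finite_subset[OF J I]
    by (simp add: h_def M_def Un_absorb1)
  have hQ: "Q (h (f, g)) \<longleftrightarrow> Q f" and hR: "R (h (f, g)) \<longleftrightarrow> R g" for f g
    by (rule Q, simp add: h_def) (rule R, simp add: h_def)
  have "h -` {X. Q X \<and> R X} = {X. Q X} \<times> {X. R X}" "h -` {X. Q X} = {X. Q X} \<times> UNIV"
    "h -` {X. R X} = UNIV \<times> {X. R X}"
    using hQ hR by auto
  then show ?thesis
    by (simp add: eq measure_map_pmf M_def prob_pair_pmf_Times)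
qed

lemma finite_vertex_pairs: "finite (vertex_pairs n)"
  by (rule finite_subset[of _ "Pow {1..n}"]) (auto simp: vertex_pairs_def)

text \<open>The law of the edge indicators before they are assembled into a graph; here the pairs of
  vertices are independent coordinates.\<close>

definition edge_pmf :: "nat \<Rightarrow> real \<Rightarrow> (nat set \<Rightarrow> bool) pmf" where
  "edge_pmf n p = Pi_pmf (vertex_pairs n) False (\<lambda>_. bernoulli_pmf p)"

lemma prob_no_edges:
  assumes "F \<subseteq> vertex_pairs n" "0 \<le> p" "p \<le> 1"
  shows "measure_pmf.prob (edge_pmf n p) {X. \<forall>e\<in>F. \<not> X e} = (1 - p) ^ card F"
proof -
  define B where "B = (\<lambda>e. if e \<in> F then {False} else UNIV)"
  have "measure_pmf.prob (edge_pmf n p) {X. \<forall>e\<in>F. \<not> X e} =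
      measure_pmf.prob (edge_pmf n p) (Pi (vertex_pairs n) B)"
    using assms(1) by (intro arg_cong[where f = "measure_pmf.prob _"]) (auto simp: B_def Pi_def)
  also have "\<dots> = (\<Prod>e\<in>vertex_pairs n. measure_pmf.prob (bernoulli_pmf p) (B e))"
    unfolding edge_pmf_def by (rule measure_Pi_pmf_Pi[OF finite_vertex_pairs])
  also have "\<dots> = (\<Prod>e\<in>vertex_pairs n. if e \<in> F then 1 - p else 1)"
    using assms by (intro prod.cong) (auto simp: B_def measure_pmf_single)
  also have "\<dots> = (1 - p) ^ card F"
    using assms(1) finite_vertex_pairs
    by (simp add: prod.If_cases Int_absorb1)
  finally show ?thesis .
qed

lemma pair_in_vertex_pairs:
  "u \<in> {1..n} \<Longrightarrow> w \<in> {1..n} \<Longrightarrow> u \<noteq> w \<Longrightarrow> {u, w} \<in> vertex_pairs n"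
  by (auto simp: vertex_pairs_def)

lemma card_star:
  assumes "u \<notin> S"
  shows "card ((\<lambda>w. {u, w}) ` S) = card S"
  using assms by (intro card_image) (auto simp: inj_on_def doubleton_eq_iff)

text \<open>The target \<open>U\<close> is a separate parameter because several targets occur: the
  complement of one set, of a pair of disjoint sets, and of the union of two candidate sets.\<close>

definition dominates :: "(nat set \<Rightarrow> bool) \<Rightarrow> nat set \<Rightarrow> nat set \<Rightarrow> bool" where
  "dominates X S U \<longleftrightarrow> (\<forall>v\<in>U. \<exists>w\<in>S. X {v, w})"

text \<open>Inclusion-exclusion for the events \<open>N S\<close> and \<open>N T\<close> that
  \<open>u\<close> has no neighbour in \<open>S\<close> or none in \<open>T\<close>; together they
  say that \<open>u\<close> has none in \<open>S \<union> T\<close>.\<close>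

lemma prob_adjacent_both:
  assumes "S \<subseteq> {1..n}" "T \<subseteq> {1..n}" "u \<in> {1..n}" "u \<notin> S" "u \<notin> T" "0 \<le> p" "p \<le> 1"
  shows "measure_pmf.prob (edge_pmf n p) {X. (\<exists>w\<in>S. X {u, w}) \<and> (\<exists>w\<in>T. X {u, w})} =
    1 - (1 - p) ^ card S - (1 - p) ^ card T + (1 - p) ^ card (S \<union> T)"
proof -
  define N where "N S = {X. \<forall>e\<in>(\<lambda>w. {u, w}) ` S. \<not> X e}" for S :: "nat set"
  let ?P = "measure_pmf.prob (edge_pmf n p)"
  have P: "?P (N A) = (1 - p) ^ card A" if "A \<subseteq> {1..n}" "u \<notin> A" for A
    unfolding N_def using that assms
    by (subst prob_no_edges) (auto simp: card_star intro!: pair_in_vertex_pairs)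
  have "{X. (\<exists>w\<in>S. X {u, w}) \<and> (\<exists>w\<in>T. X {u, w})} = UNIV - (N S \<union> N T)"
    by (auto simp: N_def)
  moreover have "?P (N S \<union> N T) = ?P (N S) + ?P (N T) - ?P (N S \<inter> N T)"
    using measure_pmf.finite_measure_Union'[where M = "edge_pmf n p" and A = "N S" and B = "N T"]
      measure_pmf.finite_measure_Diff'[where M = "edge_pmf n p" and A = "N T" and B = "N S"]
    by (simp add: Int_commute)
  moreover have "N S \<inter> N T = N (S \<union> T)"
    by (auto simp: N_def)
  moreover have "?P (UNIV - (N S \<union> N T)) = 1 - ?P (N S \<union> N T)"
    using measure_pmf.prob_compl[where M = "edge_pmf n p" and A = "N S \<union> N T"] by simp
  ultimately show ?thesis
    using assms by (simp add: P)
qed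

text \<open>Since \<open>U\<close> does not meet \<open>S \<union> T\<close>, distinct vertices of
  \<open>U\<close> use disjoint sets of pairs. Their conditions are therefore independent, and each
  contributes the same factor.\<close>

lemma prob_dominates_both:
  assumes "S \<subseteq> {1..n}" "T \<subseteq> {1..n}" "U \<subseteq> {1..n}" "U \<inter> (S \<union> T) = {}" "0 \<le> p" "p \<le> 1"
  shows "measure_pmf.prob (edge_pmf n p) {X. dominates X S U \<and> dominates X T U} =
    (1 - (1 - p) ^ card S - (1 - p) ^ card T + (1 - p) ^ card (S \<union> T)) ^ card U"
proof -
  have "finite U" using assms(3) finite_subset by blast
  then show ?thesis
    using assms(3,4)
  proof (induction U)
    case empty
    then show ?case by (simp add: dominates_def)
  next
    case (insert u U)
    let ?J = "(\<lambda>w. {u, w}) ` (S \<union> T)"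
    have "{X. dominates X S (insert u U) \<and> dominates X T (insert u U)} =
      {X. ((\<exists>w\<in>S. X {u, w}) \<and> (\<exists>w\<in>T. X {u, w})) \<and> (dominates X S U \<and> dominates X T U)}"
      by (auto simp: dominates_def)
    also have "measure_pmf.prob (edge_pmf n p) \<dots> =
      measure_pmf.prob (edge_pmf n p) {X. (\<exists>w\<in>S. X {u, w}) \<and> (\<exists>w\<in>T. X {u, w})} *
      measure_pmf.prob (edge_pmf n p) {X. dominates X S U \<and> dominates X T U}"
      unfolding edge_pmf_def
    proof (rule prob_Pi_pmf_indep[OF finite_vertex_pairs, where J = ?J])
      show "?J \<subseteq> vertex_pairs n"
        using insert.prems assms by (auto intro!: pair_in_vertex_pairs)
      fix X Y :: "nat set \<Rightarrow> bool"
      show "((\<exists>w\<in>S. X {u, w}) \<and> (\<exists>w\<in>T. X {u, w})) \<longleftrightarrow> ((\<exists>w\<in>S. Y {u, w}) \<and> (\<exists>w\<in>T. Y {u, w}))"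
        if XY: "\<And>i. i \<in> ?J \<Longrightarrow> X i = Y i"
      proof -
        have "X {u, w} = Y {u, w}" if "w \<in> S \<union> T" for w
          using that by (intro XY imageI)
        then show ?thesis by auto
      qed
      assume XY: "\<And>i. i \<in> vertex_pairs n - ?J \<Longrightarrow> X i = Y i"
      \<comment> \<open>Neither end of such a pair is \<open>u\<close>, so the pair lies outside the
        star \<open>?J\<close> and the event for \<open>U\<close> depends only on the remaining
        coordinates.\<close>
      have "X {v, w} = Y {v, w}" if "v \<in> U" "w \<in> S \<union> T" for v w
      proof (rule XY)
        have "v \<noteq> u" "w \<noteq> u" "v \<noteq> w" "v \<in> {1..n}" "w \<in> {1..n}"
          using that insert.hyps insert.prems assms(1,2) by auto
        moreover from this have "{v, w} \<notin> ?J"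
          by (metis (no_types, lifting) doubleton_eq_iff imageE)
        ultimately show "{v, w} \<in> vertex_pairs n - ?J"
          by (simp add: pair_in_vertex_pairs)
      qed
      then show "(dominates X S U \<and> dominates X T U) \<longleftrightarrow> (dominates Y S U \<and> dominates Y T U)"
        by (simp add: dominates_def)
    qed
    also have "measure_pmf.prob (edge_pmf n p) {X. (\<exists>w\<in>S. X {u, w}) \<and> (\<exists>w\<in>T. X {u, w})} =
        1 - (1 - p) ^ card S - (1 - p) ^ card T + (1 - p) ^ card (S \<union> T)"
      using insert.prems assms by (intro prob_adjacent_both) auto
    finally show ?case
      using insert.IH insert.prems insert.hyps by simp
  qed
qed

lemma prob_dominates:
  assumes "S \<subseteq> {1..n}" "U \<subseteq> {1..n}" "U \<inter> S = {}" "0 \<le> p" "p \<le> 1"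
  shows "measure_pmf.prob (edge_pmf n p) {X. dominates X S U} = (1 - (1 - p) ^ card S) ^ card U"
  using prob_dominates_both[of S n S U p] assms by simp

subsection \<open>First and second moments\<close>

lemma sum_power_card_Pow:
  fixes x :: "'b::comm_semiring_1"
  assumes "finite S"
  shows "(\<Sum>A\<in>Pow S. x ^ card A) = (1 + x) ^ card S"
proof -
  have "(\<Prod>i\<in>S. x + 1) = (\<Sum>A\<in>Pow S. (\<Prod>i\<in>A. x) * (\<Prod>i\<in>S - A. 1))"
    by (rule prod_add[OF assms])
  then show ?thesis by (simp add: add.commute)
qed

text \<open>This is \<open>(1 + 1 / n) ^ n \<le> exp 1\<close>. Weighted in this way, a sum over all
  subsets costs only a constant, so no binomial coefficient has to be estimated.\<close>

lemma sum_inverse_power_card_Pow_le: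
  assumes "finite S" "card S \<le> n"
  shows "(\<Sum>A\<in>Pow S. (1 / real n) ^ card A) \<le> exp 1"
proof -
  have "(\<Sum>A\<in>Pow S. (1 / real n) ^ card A) = (1 + 1 / real n) ^ card S"
    by (rule sum_power_card_Pow[OF assms(1)])
  also have "\<dots> \<le> exp (1 / real n) ^ card S"
    by (intro power_mono) (auto intro: exp_ge_add_one_self)
  also have "\<dots> = exp (real (card S) * (1 / real n))"
    by (rule exp_of_nat_mult[symmetric])
  also have "\<dots> \<le> exp 1"
    using assms(2) by (auto simp: divide_le_eq)
  finally show ?thesis .
qed

text \<open>Union bound over the pairs \<open>(A, B)\<close>. The factor \<open>n ^ (k + j)\<close>
  in \<open>bound\<close> gives each pair the weight \<open>n\<close> to the power
  \<open>- (|A| + |B|)\<close>; after enlarging the sum to all pairs of subsets it factorises into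
  two sums, each at most \<open>exp 1\<close>.\<close>

lemma prob_light_dominating_le:
  fixes n :: nat and p c a \<epsilon> :: real
  assumes p: "0 \<le> p" "p \<le> 1" and n: "n > 0" and eps: "\<epsilon> \<ge> 0"
    and bound: "\<And>k j. real k + c * real j \<le> a \<Longrightarrow> (1 - (1 - p) ^ k) ^ (n - (k + j)) * real n ^ (k + j) \<le> \<epsilon>"
  shows "measure_pmf.prob (edge_pmf n p)
    {X. \<exists>A B. A \<subseteq> {1..n} \<and> B \<subseteq> {1..n} \<and> A \<inter> B = {} \<and> real (card A) + c * real (card B) \<le> a \<and>
      dominates X A ({1..n} - A - B)} \<le> exp 1 * exp 1 * \<epsilon>"
proof -
  let ?P = "measure_pmf.prob (edge_pmf n p)"
  define Z where "Z = {(A, B). A \<subseteq> {1..n} \<and> B \<subseteq> {1..n} \<and> A \<inter> B = {} \<and> real (card A) + c * real (card B) \<le> a}"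
  define W where "W = Pow {1..n}"
  define g :: "nat set \<Rightarrow> real" where "g A = (1 / real n) ^ card A" for A
  have g: "g A \<ge> 0" for A
    by (simp add: g_def)
  have gW: "sum g W \<le> exp 1"
    unfolding g_def W_def by (rule sum_inverse_power_card_Pow_le) simp_all
  have finW: "finite W" and Z: "Z \<subseteq> W \<times> W"
    by (auto simp: Z_def W_def)
  then have finZ: "finite Z"
    using finite_subset by blast
  have term_le: "?P {X. dominates X (fst z) ({1..n} - fst z - snd z)} \<le>
      \<epsilon> * ((1 / real n) ^ card (fst z) * (1 / real n) ^ card (snd z))" if "z \<in> Z" for z
  proof -
    obtain A B where z: "z = (A, B)" by force
    have AB: "A \<subseteq> {1..n}" "B \<subseteq> {1..n}" "A \<inter> B = {}" "real (card A) + c * real (card B) \<le> a"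
      using that by (auto simp: Z_def z)
    have fin: "finite A" "finite B"
      using AB finite_subset by blast+
    have "card ({1..n} - A - B) = card ({1..n} - (A \<union> B))"
      by (rule arg_cong[where f = card]) auto
    also have "\<dots> = n - (card A + card B)"
      using AB fin by (subst card_Diff_subset) (auto simp: card_Un_disjoint)
    finally have "?P {X. dominates X A ({1..n} - A - B)} = (1 - (1 - p) ^ card A) ^ (n - (card A + card B))"
      using AB p by (subst prob_dominates) auto
    also have "\<dots> \<le> \<epsilon> / real n ^ (card A + card B)"
      using bound[OF AB(4)] n by (simp add: le_divide_eq)
    also have "\<dots> = \<epsilon> * ((1 / real n) ^ card A * (1 / real n) ^ card B)"
      by (simp add: power_add power_one_over)
    finally show ?thesis
      by (simp only: z fst_conv snd_conv)
  qed
  have "?P {X. \<exists>A B. A \<subseteq> {1..n} \<and> B \<subseteq> {1..n} \<and> A \<inter> B = {} \<and> real (card A) + c * real (card B) \<le> a \<and>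
      dominates X A ({1..n} - A - B)} \<le> ?P (\<Union>z\<in>Z. {X. dominates X (fst z) ({1..n} - fst z - snd z)})"
  proof (intro measure_pmf.finite_measure_mono subsetI)
    fix X assume "X \<in> {X. \<exists>A B. A \<subseteq> {1..n} \<and> B \<subseteq> {1..n} \<and> A \<inter> B = {} \<and>
      real (card A) + c * real (card B) \<le> a \<and> dominates X A ({1..n} - A - B)}"
    then obtain A B where "(A, B) \<in> Z" "dominates X A ({1..n} - A - B)"
      unfolding Z_def by blast
    then show "X \<in> (\<Union>z\<in>Z. {X. dominates X (fst z) ({1..n} - fst z - snd z)})"
      by (intro UN_I[of "(A, B)"]) simp_all
  qed simp
  also have "\<dots> \<le> (\<Sum>z\<in>Z. ?P {X. dominates X (fst z) ({1..n} - fst z - snd z)})"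
    by (intro measure_pmf.finite_measure_subadditive_finite finZ) simp
  also have "\<dots> \<le> (\<Sum>z\<in>Z. \<epsilon> * (g (fst z) * g (snd z)))"
    unfolding g_def by (rule sum_mono[OF term_le])
  also have "\<dots> \<le> (\<Sum>z\<in>W \<times> W. \<epsilon> * (g (fst z) * g (snd z)))"
    using Z eps g finW by (intro sum_mono2) auto
  also have "\<dots> = \<epsilon> * (\<Sum>z\<in>W \<times> W. g (fst z) * g (snd z))"
    by (rule sum_distrib_left[symmetric])
  also have "\<dots> = \<epsilon> * (sum g W * sum g W)"
    unfolding sum_product sum.cartesian_product by (simp only: case_prod_unfold)
  also have "\<dots> \<le> \<epsilon> * (exp 1 * exp 1)"
    using eps gW g by (intro mult_left_mono mult_mono) (auto intro: sum_nonneg)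
  also have "\<dots> = exp 1 * exp 1 * \<epsilon>"
    by (rule mult.commute)
  finally show ?thesis .
qed

text \<open>Chebyshev's argument for the number \<open>Z\<close> of events that occur: where
  \<open>Z = 0\<close>, the squared deviation from the mean is the squared mean. Not dividing by it
  keeps the inequality valid when the mean is zero.\<close>

lemma second_moment_method:
  fixes M :: "'a pmf" and E :: "'b \<Rightarrow> 'a set"
  defines "\<mu> \<equiv> \<lambda>F. \<Sum>S\<in>F. measure_pmf.prob M (E S)"
  assumes "finite F"
  shows "(\<mu> F)\<^sup>2 * measure_pmf.prob M {X. \<forall>S\<in>F. X \<notin> E S} \<le>
    (\<Sum>S\<in>F. \<Sum>T\<in>F. measure_pmf.prob M (E S \<inter> E T)) - (\<mu> F)\<^sup>2"
proof -
  define Z where "Z X = (\<Sum>S\<in>F. indicator (E S) X :: real)" for X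
  have int: "integrable (measure_pmf M) (indicator A :: 'a \<Rightarrow> real)" for A
    by (simp add: measure_pmf.emeasure_eq_measure)
  have EZ: "measure_pmf.expectation M Z = \<mu> F"
    unfolding Z_def \<mu>_def using int by (subst Bochner_Integration.integral_sum) auto
  have intZ: "integrable (measure_pmf M) Z"
    unfolding Z_def using int by (intro Bochner_Integration.integrable_sum)
  have ZZ: "(Z X)\<^sup>2 = (\<Sum>S\<in>F. \<Sum>T\<in>F. indicator (E S \<inter> E T) X)" for X
    by (simp add: Z_def power2_eq_square sum_product indicator_inter_arith)
  have EZZ: "measure_pmf.expectation M (\<lambda>X. (Z X)\<^sup>2) = (\<Sum>S\<in>F. \<Sum>T\<in>F. measure_pmf.prob M (E S \<inter> E T))"
    unfolding ZZ using int by (simp add: Bochner_Integration.integral_sum)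
  have intZZ: "integrable (measure_pmf M) (\<lambda>X. (Z X)\<^sup>2)"
    unfolding ZZ using int by (intro Bochner_Integration.integrable_sum)
  have "(\<mu> F)\<^sup>2 * measure_pmf.prob M {X. \<forall>S\<in>F. X \<notin> E S} =
      measure_pmf.expectation M (\<lambda>X. (\<mu> F)\<^sup>2 * indicator {X. \<forall>S\<in>F. X \<notin> E S} X)"
    by simp
  also have "\<dots> \<le> measure_pmf.expectation M (\<lambda>X. (Z X)\<^sup>2 - 2 * \<mu> F * Z X + (\<mu> F)\<^sup>2)"
  proof (rule integral_mono)
    show "integrable (measure_pmf M) (\<lambda>X. (\<mu> F)\<^sup>2 * indicator {X. \<forall>S\<in>F. X \<notin> E S} X)"
      using int by simp
    show "integrable (measure_pmf M) (\<lambda>X. (Z X)\<^sup>2 - 2 * \<mu> F * Z X + (\<mu> F)\<^sup>2)"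
      using intZ intZZ by simp
    fix X
    have "(Z X)\<^sup>2 - 2 * \<mu> F * Z X + (\<mu> F)\<^sup>2 = (Z X - \<mu> F)\<^sup>2"
      by (simp add: power2_diff)
    moreover have "Z X = 0" if "\<forall>S\<in>F. X \<notin> E S"
      using that by (simp add: Z_def)
    ultimately show "(\<mu> F)\<^sup>2 * indicator {X. \<forall>S\<in>F. X \<notin> E S} X \<le> (Z X)\<^sup>2 - 2 * \<mu> F * Z X + (\<mu> F)\<^sup>2"
      by (cases "\<forall>S\<in>F. X \<notin> E S") auto
  qed
  also have "\<dots> = measure_pmf.expectation M (\<lambda>X. (Z X)\<^sup>2) - 2 * \<mu> F * measure_pmf.expectation M Z + (\<mu> F)\<^sup>2"
    using intZ intZZ by simp
  finally show ?thesis
    unfolding EZ EZZ by (simp add: power2_eq_square)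
qed

section \<open>Counting sets by their intersection with a fixed set\<close>

lemma card_supersets:
  assumes "M \<subseteq> V" "finite V" "card M \<le> k"
  shows "card {T. T \<subseteq> V \<and> card T = k \<and> M \<subseteq> T} = (card V - card M) choose (k - card M)"
proof -
  have finM: "finite M" using assms finite_subset by blast
  have "bij_betw (\<lambda>T. T - M) {T. T \<subseteq> V \<and> card T = k \<and> M \<subseteq> T} {T. T \<subseteq> V - M \<and> card T = k - card M}"
  proof (rule bij_betw_byWitness[where f' = "\<lambda>T. T \<union> M"])
    have "card (T \<union> M) = k" if "T \<subseteq> V - M" "card T = k - card M" for T
    proof -
      have "finite T" "T \<inter> M = {}"
        using that assms finite_subset by (blast, blast)
      then show ?thesis using that finM assms by (simp add: card_Un_disjoint)
    qed
    then show "(\<lambda>T. T \<union> M) ` {T. T \<subseteq> V - M \<and> card T = k - card M} \<subseteq> {T. T \<subseteq> V \<and> card T = k \<and> M \<subseteq> T}"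
      using assms by auto
  qed (use assms finM in \<open>auto simp: card_Diff_subset\<close>)
  then have "card {T. T \<subseteq> V \<and> card T = k \<and> M \<subseteq> T} = card {T. T \<subseteq> V - M \<and> card T = k - card M}"
    by (rule bij_betw_same_card)
  also have "\<dots> = (card V - card M) choose (k - card M)"
    using assms finM by (subst n_subsets) (auto simp: card_Diff_subset)
  finally show ?thesis .
qed

text \<open>The quotient of the two binomial coefficients is the product of
  \<open>(k - i) / (n - i)\<close> over \<open>i < m\<close>, and each factor is at most
  \<open>k / n\<close>. Denominators are cleared so that the induction stays in the natural
  numbers.\<close>

lemma binomial_diff_le:
  assumes "m \<le> k" "k \<le> n"
  shows "((n - m) choose (k - m)) * n ^ m \<le> k ^ m * (n choose k)"
  using assms(1)
proof (induction m)
  case (Suc m)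
  have "(k - m) * ((n - m) choose (k - m)) = (n - m) * ((n - Suc m) choose (k - Suc m))"
    using times_binomial_minus1_eq[of "k - m" "n - m"] Suc.prems by simp
  then have "(n - m) * (((n - Suc m) choose (k - Suc m)) * n) = ((k - m) * n) * ((n - m) choose (k - m))"
    by (simp add: mult_ac)
  also have "\<dots> \<le> (k * (n - m)) * ((n - m) choose (k - m))"
  proof (rule mult_le_mono1)
    have "k * m \<le> m * n"
      using mult_le_mono1[OF assms(2), of m] by (simp add: mult.commute)
    then show "(k - m) * n \<le> k * (n - m)"
      unfolding diff_mult_distrib diff_mult_distrib2 by (rule diff_le_mono2)
  qed
  finally have "(n - m) * (((n - Suc m) choose (k - Suc m)) * n) \<le> (n - m) * (k * ((n - m) choose (k - m)))"
    by (simp only: mult_ac)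
  then have "((n - Suc m) choose (k - Suc m)) * n \<le> k * ((n - m) choose (k - m))"
    using assms Suc.prems by simp
  then have "((n - Suc m) choose (k - Suc m)) * n * n ^ m \<le> k * (((n - m) choose (k - m)) * n ^ m)"
    by (simp add: mult.assoc[symmetric])
  also have "\<dots> \<le> k * (k ^ m * (n choose k))"
    using Suc by simp
  finally show ?case by (simp add: mult_ac)
qed simp

text \<open>The sets \<open>T\<close> are grouped by \<open>M = S \<inter> T\<close>; at most a
  fraction \<open>(k / n) ^ |M|\<close> of all \<open>k\<close>-sets contain \<open>M\<close>.
  Writing \<open>k / n\<close> as \<open>(k^2 / n) * (1 / k)\<close> leaves weights
  \<open>(1 / k) ^ |M|\<close>, whose sum over \<open>M\<close> is at most \<open>exp 1\<close>. The
  empty intersection is kept apart so that \<open>V 0\<close> has coefficient exactly 1, as a limit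
  argument for the variance requires.\<close>

lemma sum_subsets_by_intersection_le:
  fixes V :: "nat \<Rightarrow> real"
  assumes S: "S \<subseteq> {1..n}" "card S = k" and k: "0 < k" "k \<le> n"
    and V: "\<And>m. V m \<ge> 0" and B: "\<And>m. 1 \<le> m \<Longrightarrow> m \<le> k \<Longrightarrow> (real k ^ 2 / real n) ^ m * V m \<le> B" and "B \<ge> 0"
  shows "(\<Sum>T | T \<subseteq> {1..n} \<and> card T = k. V (card (S \<inter> T))) \<le> real (n choose k) * (V 0 + B * exp 1)"
proof -
  let ?F = "{T. T \<subseteq> {1..n} \<and> card T = k}"
  have finF: "finite ?F" by (rule finite_subset[of _ "Pow {1..n}"]) auto
  have finS: "finite S" using S finite_subset by blast
  have "(\<Sum>T\<in>?F. V (card (S \<inter> T))) = (\<Sum>M\<in>Pow S. \<Sum>T\<in>{T\<in>?F. S \<inter> T = M}. V (card (S \<inter> T)))"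
    using finF finS by (intro sum.group[symmetric]) auto
  also have "\<dots> \<le> (\<Sum>M\<in>Pow S. real (n choose k) * ((if M = {} then V 0 else 0) + B * (1 / real k) ^ card M))"
  proof (rule sum_mono)
    fix M assume "M \<in> Pow S"
    then have M: "M \<subseteq> S" by simp
    then have m: "card M \<le> k" using S finS by (metis card_mono)
    have "(\<Sum>T\<in>{T\<in>?F. S \<inter> T = M}. V (card (S \<inter> T))) = real (card {T\<in>?F. S \<inter> T = M}) * V (card M)"
      by simp
    also have "\<dots> \<le> real (card {T. T \<subseteq> {1..n} \<and> card T = k \<and> M \<subseteq> T}) * V (card M)"
      using V by (intro mult_right_mono of_nat_mono card_mono finite_subset[OF _ finF]) auto
    also have "\<dots> \<le> ((real k / real n) ^ card M * real (n choose k)) * V (card M)"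
    proof (rule mult_right_mono[OF _ V])
      have "card {T. T \<subseteq> {1..n} \<and> card T = k \<and> M \<subseteq> T} = (n - card M) choose (k - card M)"
        using M S m by (subst card_supersets) auto
      moreover have "real (((n - card M) choose (k - card M)) * n ^ card M) \<le> real (k ^ card M * (n choose k))"
        using binomial_diff_le[OF m k(2)] by (rule of_nat_mono)
      ultimately show "real (card {T. T \<subseteq> {1..n} \<and> card T = k \<and> M \<subseteq> T}) \<le>
          (real k / real n) ^ card M * real (n choose k)"
        using k by (simp add: power_divide pos_le_divide_eq)
    qed
    also have "\<dots> = real (n choose k) * ((real k / real n) ^ card M * V (card M))"
      by (simp only: mult_ac)
    also have "\<dots> \<le> real (n choose k) * ((if M = {} then V 0 else 0) + B * (1 / real k) ^ card M)"
    proof (rule mult_left_mono)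
      show "(real k / real n) ^ card M * V (card M) \<le> (if M = {} then V 0 else 0) + B * (1 / real k) ^ card M"
      proof (cases "M = {}")
        case False
        then have "card M \<ge> 1" using finite_subset[OF M finS] by (simp add: Suc_le_eq card_gt_0_iff)
        then have "(real k ^ 2 / real n) ^ card M * V (card M) * (1 / real k) ^ card M \<le> B * (1 / real k) ^ card M"
          using B m by (intro mult_right_mono) auto
        moreover have "(real k ^ 2 / real n) ^ card M * (1 / real k) ^ card M = (real k / real n) ^ card M"
          using k by (simp add: power_mult_distrib[symmetric] power2_eq_square)
        ultimately show ?thesis using False by (simp add: mult_ac)
      qed (use \<open>B \<ge> 0\<close> in simp)
    qed simp
    finally show "(\<Sum>T\<in>{T\<in>?F. S \<inter> T = M}. V (card (S \<inter> T))) \<le>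
        real (n choose k) * ((if M = {} then V 0 else 0) + B * (1 / real k) ^ card M)" .
  qed
  also have "\<dots> = real (n choose k) * (V 0 + B * (\<Sum>M\<in>Pow S. (1 / real k) ^ card M))"
    using finS by (simp add: sum_distrib_left[symmetric] sum.distrib sum.delta)
  also have "\<dots> \<le> real (n choose k) * (V 0 + B * exp 1)"
    using S finS \<open>B \<ge> 0\<close> by (intro mult_left_mono add_left_mono sum_inverse_power_card_Pow_le) auto
  finally show ?thesis .
qed

text \<open>The probability for one vertex factors as \<open>(1 - x)^2 * (1 + y)\<close>, where
  \<open>(1 - x)^2\<close> is the value under independence and \<open>y\<close> measures the
  correlation; then \<open>1 + y \<le> exp y\<close>.\<close>

lemma prob_dominates_both_le:
  fixes q :: real
  assumes q: "0 < q" "q < 1" and k: "1 \<le> k" "2 * k \<le> n" "m \<le> k"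
  defines "x \<equiv> q ^ k"
  shows "(1 - x - x + q ^ (2 * k - m)) ^ (n - (2 * k - m)) \<le>
    ((1 - x) ^ (n - k))\<^sup>2 * ((1 / (1 - x)) ^ (2 * k) * exp (real n * (x\<^sup>2 * ((1 / q) ^ m - 1) / (1 - x)\<^sup>2)))"
proof -
  define L where "L = n - (2 * k - m)"
  define y where "y = x\<^sup>2 * ((1 / q) ^ m - 1) / (1 - x)\<^sup>2"
  have x: "0 < x" "x < 1"
    using q k by (auto simp: x_def power_less_one_iff)
  have "(1 / q) ^ m \<ge> 1"
    using q by (intro one_le_power) auto
  then have y: "y \<ge> 0" by (simp add: y_def)
  have "q ^ (2 * k - m) * q ^ m = x\<^sup>2"
    using k by (simp add: x_def power_add[symmetric] power_mult[symmetric] mult.commute)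
  then have "q ^ (2 * k - m) = x\<^sup>2 * (1 / q) ^ m"
    using q by (simp add: power_one_over field_simps)
  moreover have "(1 - x)\<^sup>2 * (1 + y) = (1 - x)\<^sup>2 + x\<^sup>2 * ((1 / q) ^ m - 1)"
    using x by (simp add: y_def distrib_left)
  ultimately have "1 - x - x + q ^ (2 * k - m) = (1 - x)\<^sup>2 * (1 + y)"
    by (simp add: power2_eq_square algebra_simps)
  then have "(1 - x - x + q ^ (2 * k - m)) ^ L = (1 - x) ^ (2 * L) * (1 + y) ^ L"
    by (simp add: power_mult_distrib power_mult)
  also have "\<dots> \<le> (((1 - x) ^ (n - k))\<^sup>2 * (1 / (1 - x)) ^ (2 * k)) * exp (real n * y)"
  proof (intro mult_mono)
    \<comment> \<open>At least \<open>n - 2 * k\<close> vertices lie outside both sets, instead of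
      \<open>n - k\<close> outside one; the factor \<open>(1 / (1 - x)) ^ (2 * k)\<close> pays for
      the difference.\<close>
    have "(1 - x) ^ (2 * L + 2 * k) \<le> (1 - x) ^ (2 * (n - k))"
      using x k by (intro power_decreasing) (auto simp: L_def)
    then show "(1 - x) ^ (2 * L) \<le> ((1 - x) ^ (n - k))\<^sup>2 * (1 / (1 - x)) ^ (2 * k)"
      using x by (simp add: power_one_over power_add power_mult[symmetric] mult.commute pos_le_divide_eq)
    have "(1 + y) ^ L \<le> exp y ^ L"
      using y by (intro power_mono) (auto intro: exp_ge_add_one_self)
    also have "\<dots> = exp (real L * y)"
      by (rule exp_of_nat_mult[symmetric])
    also have "\<dots> \<le> exp (real n * y)"
      using y by (auto simp: L_def intro!: mult_right_mono)
    finally show "(1 + y) ^ L \<le> exp (real n * y)" .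
  qed (use x y in auto)
  finally show ?thesis
    by (simp only: L_def y_def mult.assoc)
qed

text \<open>The logarithm \<open>g\<close> of the left side is convex in \<open>m\<close>, so its
  maximum on \<open>{1..k}\<close> is attained at an end. The maximum of the two end values is then
  replaced by their sum.\<close>

lemma power_times_exp_power_le_endpoints:
  fixes r d Q :: real
  assumes "r > 0" "d \<ge> 0" "Q \<ge> 1" "1 \<le> m" "m \<le> k"
  shows "r ^ m * exp (d * (Q ^ m - 1)) \<le> r * exp (d * (Q - 1)) + r ^ k * exp (d * (Q ^ k - 1))"
proof -
  define g where "g u = u * ln r + d * (exp (u * ln Q) - 1)" for u
  have "convex_on {1..real k} g"
  proof (rule f''_ge0_imp_convex)
    show "DERIV g u :> ln r + d * (exp (u * ln Q) * ln Q)" for u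
      unfolding g_def by (auto intro!: derivative_eq_intros)
    show "DERIV (\<lambda>u. ln r + d * (exp (u * ln Q) * ln Q)) u :> d * (exp (u * ln Q) * ln Q * ln Q)" for u
      by (auto intro!: derivative_eq_intros)
  qed (use assms in auto)
  then have "g (real m) \<le> max (g 1) (g (real k))"
    using assms by (intro convex_on_le_max[where x = 1]) auto
  then have "exp (g (real m)) \<le> max (exp (g 1)) (exp (g (real k)))"
    by (auto simp: max_def split: if_splits)
  also have "\<dots> \<le> exp (g 1) + exp (g (real k))"
    by simp
  finally have "exp (g (real m)) \<le> exp (g (real 1)) + exp (g (real k))"
    by simp
  moreover have "exp (g (real i)) = r ^ i * exp (d * (Q ^ i - 1))" for i
    using assms unfolding g_def by (simp add: exp_add exp_of_nat_mult)
  ultimately show ?thesis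
    by (metis power_one_right)
qed

text \<open>Second moment method for the \<open>k\<close>-sets. Disjoint pairs yield the leading
  factor \<open>(1 / (1 - x)) ^ (2 * k)\<close>; the two summands after \<open>exp 1\<close> come
  from the endpoints \<open>m = 1\<close> and \<open>m = k\<close> of the intersection size.\<close>

lemma prob_no_dominating_set_le:
  fixes p :: real and k n :: nat
  assumes p: "0 < p" "p < 1" and k: "1 \<le> k" "2 * k \<le> n"
  defines "x \<equiv> (1 - p) ^ k"
  shows "measure_pmf.prob (edge_pmf n p)
      {X. \<forall>S. S \<subseteq> {1..n} \<and> card S = k \<longrightarrow> \<not> dominates X S ({1..n} - S)} \<le>
    (1 / (1 - x)) ^ (2 * k) *
      (1 + exp 1 * (real k ^ 2 / real n * exp (real n * x\<^sup>2 * (1 / (1 - p) - 1) / (1 - x)\<^sup>2) +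
        (real k ^ 2 / real n) ^ k * exp (real n * x / (1 - x)\<^sup>2))) - 1"
proof -
  let ?F = "{S. S \<subseteq> {1..n} \<and> card S = k}"
  let ?P = "measure_pmf.prob (edge_pmf n p)"
  define E where "E S = {X. dominates X S ({1..n} - S)}" for S
  define d where "d = real n * x\<^sup>2 / (1 - x)\<^sup>2"
  define c where "c = (1 / (1 - x)) ^ (2 * k)"
  define V where "V m = c * exp (d * ((1 / (1 - p)) ^ m - 1))" for m
  define C where "C = real k ^ 2 / real n * exp (real n * x\<^sup>2 * (1 / (1 - p) - 1) / (1 - x)\<^sup>2) +
        (real k ^ 2 / real n) ^ k * exp (real n * x / (1 - x)\<^sup>2)"
  define P0 where "P0 = (1 - x) ^ (n - k)"
  have x: "0 < x" "x < 1"
    using p k by (auto simp: x_def power_less_one_iff)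
  have d: "d \<ge> 0" and c: "c > 0" and P0: "P0 > 0"
    using x by (auto simp: d_def c_def P0_def)
  have finF: "finite ?F"
    by (rule finite_subset[of _ "Pow {1..n}"]) auto
  have prob: "?P (E S) = P0" if "S \<in> ?F" for S
  proof -
    have "card ({1..n} - S) = n - k"
      using that finite_subset by (subst card_Diff_subset) auto
    then show ?thesis
      unfolding E_def P0_def x_def using that p by (subst prob_dominates) auto
  qed
  have cardF: "card ?F = n choose k"
    by (subst n_subsets) auto
  have \<mu>: "(\<Sum>S\<in>?F. ?P (E S)) = real (n choose k) * P0"
    unfolding cardF[symmetric] sum_constant[symmetric] by (intro sum.cong refl prob)
  have pair: "?P (E S \<inter> E T) \<le> P0\<^sup>2 * V (card (S \<inter> T))" if "S \<in> ?F" "T \<in> ?F" for S T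
  proof -
    let ?m = "card (S \<inter> T)"
    have ST: "S \<subseteq> {1..n}" "T \<subseteq> {1..n}" "card S = k" "card T = k"
      using that by auto
    have fin: "finite S" "finite T"
      using ST finite_subset by blast+
    have m: "?m \<le> k"
      using ST fin by (metis card_mono inf_le1)
    have un: "card (S \<union> T) = 2 * k - ?m"
      using card_Un_Int[OF fin] ST by simp
    \<comment> \<open>Only the vertices outside both sets are kept: there the conditions at
      different vertices are independent.\<close>
    have "?P (E S \<inter> E T) \<le> ?P {X. dominates X S ({1..n} - (S \<union> T)) \<and> dominates X T ({1..n} - (S \<union> T))}"
      by (intro measure_pmf.finite_measure_mono) (auto simp: E_def dominates_def)
    also have "\<dots> = (1 - x - x + (1 - p) ^ (2 * k - ?m)) ^ (n - (2 * k - ?m))"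
    proof -
      have "card ({1..n} - (S \<union> T)) = n - (2 * k - ?m)"
        using ST fin by (subst card_Diff_subset) (auto simp: un)
      then show ?thesis
        using ST p by (subst prob_dominates_both) (auto simp: un x_def)
    qed
    also have "\<dots> \<le> ((1 - x) ^ (n - k))\<^sup>2 * ((1 / (1 - x)) ^ (2 * k) *
        exp (real n * (x\<^sup>2 * ((1 / (1 - p)) ^ ?m - 1) / (1 - x)\<^sup>2)))"
      unfolding x_def using p k m by (intro prob_dominates_both_le) auto
    also have "\<dots> = P0\<^sup>2 * V ?m"
      by (simp add: P0_def V_def c_def d_def)
    finally show ?thesis .
  qed
  have V0: "V 0 = c" by (simp add: V_def)
  have VB: "(real k ^ 2 / real n) ^ m * V m \<le> c * C" if "1 \<le> m" "m \<le> k" for m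
  proof -
    have "(real k ^ 2 / real n) ^ m * exp (d * ((1 / (1 - p)) ^ m - 1)) \<le>
        real k ^ 2 / real n * exp (d * (1 / (1 - p) - 1)) +
        (real k ^ 2 / real n) ^ k * exp (d * ((1 / (1 - p)) ^ k - 1))"
      using k p that d by (intro power_times_exp_power_le_endpoints) auto
    also have "\<dots> \<le> C"
    proof -
      have "(1 / (1 - p)) ^ k = 1 / x"
        by (simp add: x_def power_one_over)
      \<comment> \<open>At the endpoint \<open>m = k\<close> one factor \<open>x\<close> of
        \<open>x\<^sup>2\<close> cancels against \<open>(1 / (1 - p)) ^ k = 1 / x\<close>.\<close>
      moreover have "x\<^sup>2 * (1 / x - 1) \<le> x"
        using x by (simp add: power2_eq_square field_simps)
      ultimately have "d * ((1 / (1 - p)) ^ k - 1) \<le> real n * x / (1 - x)\<^sup>2"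
        unfolding d_def by (simp add: divide_right_mono mult_left_mono mult.assoc)
      then show ?thesis
        unfolding C_def d_def by (intro add_mono mult_left_mono) (auto simp: mult_ac)
    qed
    finally show ?thesis
      using c by (simp add: V_def mult.left_commute)
  qed
  have C0: "C \<ge> 0"
    by (simp add: C_def)
  have "(\<Sum>S\<in>?F. \<Sum>T\<in>?F. ?P (E S \<inter> E T)) \<le> (\<Sum>S\<in>?F. P0\<^sup>2 * (\<Sum>T\<in>?F. V (card (S \<inter> T))))"
    unfolding sum_distrib_left by (intro sum_mono pair)
  also have "\<dots> \<le> (\<Sum>S\<in>?F. P0\<^sup>2 * (real (n choose k) * (V 0 + c * C * exp 1)))"
    using k c C0 VB
    by (intro sum_mono mult_left_mono sum_subsets_by_intersection_le) (auto simp: V_def)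
  also have "\<dots> = (real (n choose k) * P0)\<^sup>2 * (c * (1 + exp 1 * C))"
    unfolding sum_constant cardF V0 by (simp add: power2_eq_square algebra_simps)
  finally have le: "(\<Sum>S\<in>?F. \<Sum>T\<in>?F. ?P (E S \<inter> E T)) \<le> (real (n choose k) * P0)\<^sup>2 * (c * (1 + exp 1 * C))" .
  have "(real (n choose k) * P0)\<^sup>2 * ?P {X. \<forall>S\<in>?F. X \<notin> E S} \<le>
      (\<Sum>S\<in>?F. \<Sum>T\<in>?F. ?P (E S \<inter> E T)) - (real (n choose k) * P0)\<^sup>2"
    using second_moment_method[OF finF, of "edge_pmf n p" E] unfolding \<mu> .
  also have "\<dots> \<le> (real (n choose k) * P0)\<^sup>2 * (c * (1 + exp 1 * C) - 1)"
    using le by (simp add: algebra_simps)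
  finally have "?P {X. \<forall>S\<in>?F. X \<notin> E S} \<le> c * (1 + exp 1 * C) - 1"
    using P0 k by (subst (asm) mult_le_cancel_left_pos) auto
  also have "{X. \<forall>S\<in>?F. X \<notin> E S} = {X. \<forall>S. S \<subseteq> {1..n} \<and> card S = k \<longrightarrow> \<not> dominates X S ({1..n} - S)}"
    by (auto simp: E_def)
  finally show ?thesis
    by (simp only: c_def C_def)
qed

subsection \<open>Asymptotics\<close>

text \<open>Natural logarithms only, the form in which the asymptotic estimates are carried
  out.\<close>

lemma a_val_eq:
  assumes "0 < p" "p < 1"
  shows "a_val p n = ln (real n / ((ln (real n))\<^sup>2 / (- ln (1 - p)))) / (- ln (1 - p))"
proof -
  have "ln (1 / (1 - p)) = - ln (1 - p)"
    using assms by (simp add: ln_div)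
  then show ?thesis
    by (simp add: a_val_def log_def power2_eq_square)
qed

lemma exp_a_val:
  assumes "0 < p" "p < 1" "2 \<le> n"
  shows "exp (ln (1 - p) * a_val p n) = (ln (real n))\<^sup>2 / (- ln (1 - p)) / real n"
proof -
  have b: "ln (1 - p) < 0" and n: "ln (real n) > 0"
    using assms by auto
  have "ln (1 - p) * a_val p n = - ln (real n / ((ln (real n))\<^sup>2 / (- ln (1 - p))))"
    using b by (simp add: a_val_eq[OF assms(1,2)])
  moreover have "real n / ((ln (real n))\<^sup>2 / (- ln (1 - p))) > 0"
    using b n assms by (intro divide_pos_pos) auto
  ultimately have "exp (ln (1 - p) * a_val p n) = inverse (real n / ((ln (real n))\<^sup>2 / (- ln (1 - p))))"
    by (simp only: exp_minus exp_ln)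
  then show ?thesis
    by simp
qed

lemma power_eq_exp_mult_ln:
  assumes "0 < p" "p < (1 :: real)"
  shows "(1 - p) ^ k = exp (ln (1 - p) * real k)"
  using assms by (simp add: exp_of_nat_mult mult.commute)

text \<open>The logarithm of the term is bounded by a function linear in \<open>j\<close>, whose
  coefficient is nonpositive by \<open>slope\<close>; hence \<open>j = 0\<close> is the worst case.
  There the choice of \<open>a\<close> cancels the main term and leaves the stated exponent.\<close>

lemma light_dominating_term_le:
  fixes p c :: real and n k j :: nat
  defines "b \<equiv> - ln (1 - p)" and "a \<equiv> a_val p n"
  assumes p: "0 < p" "p < 1" and c: "0 < c" "c < 1" and n: "2 \<le> n"
    and slope: "(1 - c) * ln n - ((ln n)\<^sup>2 / b) * b * c * (1 - a / (c * n)) \<le> 0"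
    and a_le: "a / (c * n) \<le> 1" and kj: "k + c * j \<le> a"
  shows "(1 - (1 - p) ^ k) ^ (n - (k + j)) * real n ^ (k + j) \<le>
    exp ((ln n)\<^sup>2 / b * a / (c * n) - ln n * ln ((ln n)\<^sup>2 / b) / b)"
proof -
  define l where "l = (ln (real n))\<^sup>2 / b"
  define N where "N = n - (k + j)"
  define x where "x = (1 - p) ^ k"
  define w where "w = 1 - a / (c * n)"
  have b: "b > 0" and lnn: "ln (real n) > 0"
    using p n by (auto simp: b_def)
  then have l: "l > 0" by (simp add: l_def)
  have w: "w \<ge> 0" using a_le by (simp add: w_def)
  have "c * real k \<le> 1 * real k"
    using c by (intro mult_right_mono) auto
  \<comment> \<open>At most \<open>a / c\<close> vertices are removed, so the proportion that has to
    be dominated is at least \<open>w\<close>.\<close>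
  then have "c * real (k + j) \<le> a"
    using kj by (simp add: distrib_left)
  then have kj_le: "real (k + j) \<le> a / c"
    using c by (simp add: pos_le_divide_eq mult.commute)
  have "a / c = a / (c * n) * n"
    using n by simp
  then have nw: "n * w = n - a / c"
    by (simp add: w_def algebra_simps)
  moreover have "n * w \<ge> 0" using w by simp
  ultimately have "real (k + j) \<le> real n" using kj_le by linarith
  then have "real N = real n - real (k + j)"
    unfolding N_def by (intro of_nat_diff) simp
  then have N: "real N \<ge> n * w"
    using nw kj_le by linarith
  have x0: "x \<ge> 0"
    using p by (simp add: x_def)
  \<comment> \<open>Shifting weight from \<open>A\<close> to \<open>B\<close> enlarges
    \<open>x\<close> by the factor \<open>exp (b * c * j)\<close>. Its linear part suffices, because
    \<open>l\<close> is of order \<open>(ln n)^2\<close> and each element of \<open>B\<close> costs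
    only a multiple of \<open>ln n\<close>.\<close>
  have x: "x \<ge> l / n * (1 + b * c * j)"
  proof -
    have "l / n * (1 + b * c * j) \<le> l / n * exp (b * c * j)"
      using l by (intro mult_left_mono) (auto intro: exp_ge_add_one_self)
    also have "\<dots> = exp (- b * a + b * c * j)"
    proof -
      have "exp (- b * a) = l / n"
        using exp_a_val[OF p n] by (simp add: b_def l_def a_def)
      then show ?thesis by (simp only: exp_add)
    qed
    also have "\<dots> \<le> exp (- b * k)"
      using kj b mult_left_mono[OF kj, of b] by (simp add: algebra_simps)
    also have "\<dots> = x"
      using power_eq_exp_mult_ln[OF p] by (simp add: x_def b_def)
    finally show ?thesis .
  qed
  have "l * (1 + b * c * j) * w = l / n * (1 + b * c * j) * (n * w)"
    using n by simp
  also have "\<dots> \<le> x * real N"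
    using x x0 N w n l b c by (intro mult_mono) auto
  finally have xN: "l * (1 + b * c * j) * w \<le> x * real N" .
  have "x \<le> 1"
    unfolding x_def using p by (intro power_le_one) auto
  then have "(1 - x) ^ N \<le> exp (- x) ^ N"
    using exp_ge_add_one_self[of "- x"] by (intro power_mono) auto
  then have "(1 - x) ^ N * real n ^ (k + j) \<le> exp (- x) ^ N * real n ^ (k + j)"
    by (intro mult_right_mono) auto
  also have "\<dots> = exp (real (k + j) * ln (real n) - x * real N)"
  proof -
    have "exp (- x) ^ N = exp (- (x * real N))"
      by (simp add: exp_of_nat_mult[symmetric] mult.commute)
    moreover have "real n ^ (k + j) = exp (real (k + j) * ln (real n))"
      using n by (simp only: exp_of_nat_mult) simp
    ultimately show ?thesis
      by (simp add: exp_add[symmetric])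
  qed
  also have "\<dots> \<le> exp (l * a / (c * n) - ln n * ln l / b)"
  proof -
    have "real (k + j) \<le> a + (1 - c) * j"
      using kj by (simp add: algebra_simps)
    then have "real (k + j) * ln n \<le> (a + (1 - c) * j) * ln n"
      using lnn by (intro mult_right_mono) auto
    then have "real (k + j) * ln n - x * real N \<le> (a + (1 - c) * j) * ln n - l * (1 + b * c * j) * w"
      using xN by linarith
    also have "\<dots> = a * ln n - l * w + j * ((1 - c) * ln n - l * b * c * w)"
      by (simp add: algebra_simps)
    also have "\<dots> \<le> a * ln n - l * w"
      using slope by (simp add: l_def w_def mult_nonneg_nonpos)
    \<comment> \<open>The cancellation that fixes the threshold: \<open>a * ln n\<close> and
      \<open>l\<close> agree up to a term of order \<open>ln n * ln l\<close>, which has the right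
      sign.\<close>
    also have "a * ln n = l - ln n * ln l / b"
    proof -
      have "a = (ln n - ln l) / b"
        using n l b p unfolding a_def by (simp add: a_val_eq b_def[symmetric] l_def[symmetric] ln_div)
      then have "a * ln n = ln n * ln n / b - ln n * ln l / b"
        by (simp only: times_divide_eq_left times_divide_eq_right left_diff_distrib right_diff_distrib
            diff_divide_distrib mult.commute)
      then show ?thesis
        by (simp add: l_def power2_eq_square)
    qed
    also have "l - ln n * ln l / b - l * w = l * a / (c * n) - ln n * ln l / b"
      by (simp add: w_def algebra_simps)
    finally show ?thesis by simp
  qed
  finally show ?thesis
    by (simp only: x_def N_def l_def)
qed

text \<open>In the exponent of \<open>\<epsilon>\<close> the first term tends to 0 and the
  subtracted one to infinity. The side conditions hold eventually since \<open>(ln n)^2\<close>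
  outgrows \<open>ln n\<close> and \<open>a_val p n\<close> is of order \<open>ln n\<close>.\<close>

lemma prob_light_dominating_tendsto_0:
  fixes p c :: real
  assumes p: "0 < p" "p < 1" and c: "0 < c" "c < 1"
  shows "(\<lambda>n. measure_pmf.prob (edge_pmf n p)
    {X. \<exists>A B. A \<subseteq> {1..n} \<and> B \<subseteq> {1..n} \<and> A \<inter> B = {} \<and> real (card A) + c * real (card B) \<le> a_val p n \<and>
      dominates X A ({1..n} - A - B)}) \<longlonglongrightarrow> 0"
proof -
  define b where "b = - ln (1 - p)"
  have b: "b > 0" using p by (simp add: b_def)
  have a: "a_val p n = ln (real n / ((ln (real n))\<^sup>2 / b)) / b" for n
    using a_val_eq[OF p] by (simp add: b_def)
  define \<epsilon> where "\<epsilon> n = exp ((ln (real n))\<^sup>2 / b * a_val p n / (c * real n) -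
    ln (real n) * ln ((ln (real n))\<^sup>2 / b) / b)" for n :: nat
  have "\<epsilon> \<longlonglongrightarrow> 0"
    unfolding \<epsilon>_def a using b c by real_asymp
  then have lim: "(\<lambda>n. exp 1 * exp 1 * \<epsilon> n) \<longlonglongrightarrow> 0"
    using tendsto_mult_right_zero by blast
  have ev1: "eventually (\<lambda>n::nat. (1 - c) * ln (real n) - ((ln (real n))\<^sup>2 / b) * b * c *
      (1 - a_val p n / (c * real n)) \<le> 0) sequentially"
    unfolding a using b c by real_asymp
  have ev2: "eventually (\<lambda>n::nat. a_val p n / (c * real n) \<le> 1) sequentially"
    unfolding a using b c by real_asymp
  show ?thesis
  proof (rule tendsto_sandwich[OF _ _ tendsto_const lim])
    show "eventually (\<lambda>n. measure_pmf.prob (edge_pmf n p)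
      {X. \<exists>A B. A \<subseteq> {1..n} \<and> B \<subseteq> {1..n} \<and> A \<inter> B = {} \<and> real (card A) + c * real (card B) \<le> a_val p n \<and>
        dominates X A ({1..n} - A - B)} \<le> exp 1 * exp 1 * \<epsilon> n) sequentially"
      using ev1 ev2 eventually_ge_at_top[of 2]
    proof eventually_elim
      case (elim n)
      show ?case
      proof (rule prob_light_dominating_le)
        show "(1 - (1 - p) ^ k) ^ (n - (k + j)) * real n ^ (k + j) \<le> \<epsilon> n"
          if "real k + c * real j \<le> a_val p n" for k j
          unfolding \<epsilon>_def b_def using that elim p c
          by (intro light_dominating_term_le) (auto simp: b_def)
      qed (use p elim in \<open>auto simp: \<epsilon>_def\<close>)
    qed
  qed simp
qed

text \<open>The margin \<open>\<delta>\<close> decides the case of equal sets: there the exponent is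
  asymptotic to \<open>- (1 - \<theta>) * (ln n)^2 / b\<close>, which tends to minus infinity
  because \<open>\<theta> < 1\<close>.\<close>

lemma prob_no_dominating_set_tendsto_0:
  fixes p \<delta> :: real and \<kappa> :: "nat \<Rightarrow> nat"
  assumes p: "0 < p" "p < 1" and \<delta>: "\<delta> > 0"
    and \<kappa>: "eventually (\<lambda>n. a_val p n + \<delta> \<le> \<kappa> n \<and> \<kappa> n \<le> a_val p n + 2) sequentially"
  shows "(\<lambda>n. measure_pmf.prob (edge_pmf n p)
    {X. \<forall>S. S \<subseteq> {1..n} \<and> card S = \<kappa> n \<longrightarrow> \<not> dominates X S ({1..n} - S)}) \<longlonglongrightarrow> 0"
proof -
  define b where "b = - ln (1 - p)"
  have b: "b > 0" using p by (simp add: b_def)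
  define \<theta> where "\<theta> = exp (- (b * \<delta>))"
  have \<theta>: "0 < \<theta>" "\<theta> < 1" using b \<delta> by (auto simp: \<theta>_def)
  define c where "c = 1 / (1 - p) - 1"
  have c: "c > 0" using p by (simp add: c_def)
  define a where "a n = ln (real n / ((ln (real n))\<^sup>2 / b)) / b" for n :: nat
  have a: "a_val p n = a n" for n
    using a_val_eq[OF p] by (simp add: b_def a_def)
  \<comment> \<open>\<open>K\<close> and \<open>Y\<close> are real upper bounds for
    \<open>\<kappa> n\<close> and for \<open>(1 - p) ^ \<kappa> n\<close>. \<open>B1\<close> and
    \<open>B2\<close> bound the contributions of \<open>m = 1\<close> and
    \<open>m = \<kappa> n\<close>, and \<open>D\<close> bounds the leading factor.\<close>
  define K where "K n = a n + 2" for n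
  define Y where "Y n = \<theta> * ((ln (real n))\<^sup>2 / b) / real n" for n :: nat
  define B1 where "B1 n = (K n)\<^sup>2 / real n * exp (real n * (Y n)\<^sup>2 * c / (1 - Y n)\<^sup>2)" for n
  define B2 where "B2 n = exp (a n * ln ((K n)\<^sup>2 / real n) + real n * Y n / (1 - Y n)\<^sup>2)" for n
  define D where "D n = 1 / (1 - 2 * K n * Y n)" for n
  have "B1 \<longlonglongrightarrow> 0"
    unfolding B1_def K_def Y_def a_def using b c \<theta> by real_asymp
  moreover have "B2 \<longlonglongrightarrow> 0"
    unfolding B2_def K_def Y_def a_def using b \<theta> by real_asymp
  moreover have "D \<longlonglongrightarrow> 1"
    unfolding D_def K_def Y_def a_def using b \<theta> by real_asymp
  ultimately have "(\<lambda>n. D n * (1 + exp 1 * (B1 n + B2 n)) - 1) \<longlonglongrightarrow> 1 * (1 + exp 1 * (0 + 0)) - 1"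
    by (intro tendsto_intros)
  then have lim: "(\<lambda>n. D n * (1 + exp 1 * (B1 n + B2 n)) - 1) \<longlonglongrightarrow> 0"
    by simp
  have ev1: "eventually (\<lambda>n. a n > 0) sequentially"
    unfolding a_def using b by real_asymp
  have ev2: "eventually (\<lambda>n. 2 * K n \<le> real n) sequentially"
    unfolding K_def a_def using b by real_asymp
  have ev3: "eventually (\<lambda>n. (K n)\<^sup>2 / real n \<le> 1) sequentially"
    unfolding K_def a_def using b by real_asymp
  have ev4: "eventually (\<lambda>n. 2 * K n * Y n < 1) sequentially"
    unfolding K_def a_def Y_def using b \<theta> by real_asymp
  have ev5: "eventually (\<lambda>n. Y n < 1) sequentially"
    unfolding Y_def using b \<theta> by real_asymp
  show ?thesis
  proof (rule tendsto_sandwich[OF _ _ tendsto_const lim])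
    show "eventually (\<lambda>n. measure_pmf.prob (edge_pmf n p)
      {X. \<forall>S. S \<subseteq> {1..n} \<and> card S = \<kappa> n \<longrightarrow> \<not> dominates X S ({1..n} - S)} \<le>
        D n * (1 + exp 1 * (B1 n + B2 n)) - 1) sequentially"
      using \<kappa> ev1 ev2 ev3 ev4 ev5 eventually_ge_at_top[of 2]
    proof eventually_elim
      case (elim n)
      let ?k = "\<kappa> n"
      define x where "x = (1 - p) ^ ?k"
      have k: "a n \<le> ?k" "?k \<le> K n" "1 \<le> ?k" "2 * ?k \<le> n"
      proof -
        show "a n \<le> ?k" "?k \<le> K n"
          using elim \<delta> by (auto simp: a K_def)
        then have "real ?k > 0" "real (2 * ?k) \<le> real n"
          using elim by (auto simp del: of_nat_mult simp: of_nat_mult)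
        then show "1 \<le> ?k" "2 * ?k \<le> n"
          by (simp, simp only: of_nat_le_iff)
      qed
      have x0: "0 < x" using p by (simp add: x_def)
      have xY: "x \<le> Y n"
      proof -
        have "x = exp (- b * ?k)"
          using power_eq_exp_mult_ln[OF p] by (simp add: x_def b_def)
        also have "\<dots> \<le> exp (- b * (a n + \<delta>))"
          using elim b by (simp add: a)
        also have "\<dots> = \<theta> * exp (- b * a n)"
          by (simp add: \<theta>_def exp_add[symmetric] algebra_simps)
        also have "\<dots> = Y n"
          using exp_a_val[OF p, of n] elim by (simp add: Y_def b_def a)
        finally show ?thesis .
      qed
      have K2: "(real ?k)\<^sup>2 / real n \<le> (K n)\<^sup>2 / real n"
        using k by (intro divide_right_mono power_mono) auto
      have sq: "(1 - Y n)\<^sup>2 \<le> (1 - x)\<^sup>2"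
        using xY elim by (intro power_mono) auto
      have Y1: "Y n \<le> 1" and sq0: "(1 - Y n)\<^sup>2 > 0"
        using elim by simp_all
      have D: "(1 / (1 - x)) ^ (2 * ?k) \<le> D n"
      proof -
        have "2 * ?k * x \<le> 2 * K n * Y n"
          using k x0 xY elim by (intro mult_mono) auto
        \<comment> \<open>Bernoulli's inequality turns the power into the linear expression in
          \<open>D\<close>, which tends to 1 because \<open>K n * Y n\<close> tends to 0.\<close>
        moreover have "1 + real (2 * ?k) * (- x) \<le> (1 + (- x)) ^ (2 * ?k)"
          using xY elim by (intro Bernoulli_inequality) auto
        ultimately have "1 - 2 * K n * Y n \<le> (1 - x) ^ (2 * ?k)"
          by simp
        then show ?thesis
          unfolding D_def power_one_over using elim by (intro divide_left_mono) auto
      qed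
      have B1: "(real ?k)\<^sup>2 / real n * exp (real n * x\<^sup>2 * (1 / (1 - p) - 1) / (1 - x)\<^sup>2) \<le> B1 n"
        unfolding B1_def
      proof (intro mult_mono K2)
        have "real n * x\<^sup>2 * c / (1 - x)\<^sup>2 \<le> real n * (Y n)\<^sup>2 * c / (1 - Y n)\<^sup>2"
          using x0 xY Y1 c sq sq0 by (intro frac_le mult_right_mono mult_left_mono power_mono) auto
        then show "exp (real n * x\<^sup>2 * (1 / (1 - p) - 1) / (1 - x)\<^sup>2) \<le> exp (real n * (Y n)\<^sup>2 * c / (1 - Y n)\<^sup>2)"
          by (simp add: c_def)
      qed auto
      have B2: "((real ?k)\<^sup>2 / real n) ^ ?k * exp (real n * x / (1 - x)\<^sup>2) \<le> B2 n"
      proof -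
        have K0: "(K n)\<^sup>2 / real n > 0"
          using elim by (auto simp: K_def)
        have "((real ?k)\<^sup>2 / real n) ^ ?k \<le> ((K n)\<^sup>2 / real n) ^ ?k"
          by (intro power_mono K2) auto
        also have "\<dots> = exp (?k * ln ((K n)\<^sup>2 / real n))"
          using K0 by (simp only: exp_of_nat_mult exp_ln)
        also have "\<dots> \<le> exp (a n * ln ((K n)\<^sup>2 / real n))"
        proof -
          \<comment> \<open>The base is at most 1, so lowering the exponent from
            \<open>\<kappa> n\<close> to \<open>a n\<close> can only increase the power.\<close>
          have "ln ((K n)\<^sup>2 / real n) \<le> 0"
            using K0 elim by (intro ln_le_zero_iff[THEN iffD2]) auto
          then show ?thesis
            using k by (simp only: exp_le_cancel_iff mult_right_mono_neg)
        qed
        finally have "((real ?k)\<^sup>2 / real n) ^ ?k \<le> exp (a n * ln ((K n)\<^sup>2 / real n))" .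
        moreover have "real n * x / (1 - x)\<^sup>2 \<le> real n * Y n / (1 - Y n)\<^sup>2"
          using x0 xY Y1 sq sq0 by (intro frac_le mult_left_mono) auto
        ultimately show ?thesis
          unfolding B2_def exp_add by (intro mult_mono) auto
      qed
      have "measure_pmf.prob (edge_pmf n p)
          {X. \<forall>S. S \<subseteq> {1..n} \<and> card S = ?k \<longrightarrow> \<not> dominates X S ({1..n} - S)} \<le>
        (1 / (1 - x)) ^ (2 * ?k) *
        (1 + exp 1 * ((real ?k)\<^sup>2 / real n * exp (real n * x\<^sup>2 * (1 / (1 - p) - 1) / (1 - x)\<^sup>2) +
          ((real ?k)\<^sup>2 / real n) ^ ?k * exp (real n * x / (1 - x)\<^sup>2))) - 1"
        unfolding x_def using p k by (intro prob_no_dominating_set_le) auto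
      also have "\<dots> \<le> D n * (1 + exp 1 * (B1 n + B2 n)) - 1"
        using elim by (intro diff_right_mono mult_mono add_mono mult_left_mono D B1 B2)
          (auto simp: D_def)
      finally show ?case .
    qed
  qed simp
qed

subsection \<open>Self-dominating functions\<close>

definition graph_of :: "nat \<Rightarrow> (nat set \<Rightarrow> bool) \<Rightarrow> nat graph" where
  "graph_of n X = ({1..n}, {e \<in> vertex_pairs n. X e})"

lemma verts_graph_of [simp]: "verts (graph_of n X) = {1..n}"
  by (simp add: graph_of_def verts_def)

lemma in_nbhd_graph_of:
  assumes "u \<in> {1..n}"
  shows "v \<in> nbhd (graph_of n X) u \<longleftrightarrow> v \<in> {1..n} \<and> v \<noteq> u \<and> X {u, v}"
  using assms by (auto simp: nbhd_def edges_def graph_of_def verts_def vertex_pairs_def card_insert_if)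

lemma self_dominating_graph_of:
  "self_dominating c (graph_of n X) f \<longleftrightarrow>
    (\<forall>u\<in>{1..n}. f u \<ge> c \<or> (\<exists>v\<in>{1..n}. v \<noteq> u \<and> X {u, v} \<and> f v \<ge> 1))"
  by (subst self_dominating_alt) (simp, auto simp: in_nbhd_graph_of Bex_def)

text \<open>The indicator function of \<open>S\<close> is self-dominating: members of
  \<open>S\<close> have value \<open>1 \<ge> c\<close>, and every other vertex has a neighbour in
  \<open>S\<close>.\<close>

lemma sd_number_le_card:
  assumes S: "S \<subseteq> {1..n}" "dominates X S ({1..n} - S)" and c: "c \<le> 1"
  shows "sd_number c (graph_of n X) \<le> of_nat (card S)"
proof -
  define f :: "nat \<Rightarrow> ennreal" where "f u = (if u \<in> S then 1 else 0)" for u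
  have "\<exists>v\<in>{1..n}. v \<noteq> u \<and> X {u, v} \<and> f v \<ge> 1" if u: "u \<in> {1..n}" "u \<notin> S" for u
  proof -
    obtain w where "w \<in> S" "X {u, w}"
      using S(2) u unfolding dominates_def by blast
    then show ?thesis
      using S(1) u by (intro bexI[of _ w]) (auto simp: f_def)
  qed
  moreover have "f u \<ge> c" if "u \<in> S" for u
    using that c by (simp add: f_def)
  ultimately have "self_dominating c (graph_of n X) f"
    unfolding self_dominating_graph_of by blast
  then have "sd_number c (graph_of n X) \<le> weight (graph_of n X) f"
    unfolding sd_number_def by (intro Inf_lower) blast
  also have "\<dots> = (\<Sum>u\<in>{1..n} \<inter> S. 1)"
    unfolding weight_def f_def verts_graph_of by (simp only: sum.inter_restrict finite_atLeastAtMost)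
  also have "\<dots> = of_nat (card S)"
    using S(1) by (simp add: Int_absorb1)
  finally show ?thesis .
qed

text \<open>An optimal \<open>f\<close> is cut at the levels 1 and \<open>c\<close>. A vertex below
  level \<open>c\<close> must have a neighbour of value at least 1, that is, one in
  \<open>A\<close>; discarding the excess over the levels bounds the weight from below.\<close>

lemma sd_number_graph_ofE:
  assumes "0 \<le> c" "c \<le> (1 :: real)"
  obtains A B where "A \<subseteq> {1..n}" "B \<subseteq> {1..n}" "A \<inter> B = {}" "dominates X A ({1..n} - A - B)"
    "ennreal (real (card A) + c * real (card B)) \<le> sd_number (ennreal c) (graph_of n X)"
proof -
  obtain f where f: "self_dominating (ennreal c) (graph_of n X) f"
    "weight (graph_of n X) f = sd_number (ennreal c) (graph_of n X)"
    using sd_number_attained[of "graph_of n X" "ennreal c"] by auto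
  define A where "A = {u \<in> {1..n}. f u \<ge> 1}"
  define B where "B = {u \<in> {1..n}. f u \<ge> ennreal c} - A"
  have fin: "finite A" "finite B"
    by (simp_all add: A_def B_def)
  have AB: "A \<subseteq> {1..n}" "B \<subseteq> {1..n}" "A \<inter> B = {}"
    by (auto simp: A_def B_def)
  have "dominates X A ({1..n} - A - B)"
    using f(1) unfolding self_dominating_graph_of dominates_def A_def B_def by blast
  moreover have "ennreal (real (card A) + c * real (card B)) \<le> weight (graph_of n X) f"
  proof -
    have "ennreal (real (card A) + c * real (card B)) = (\<Sum>u\<in>A. 1) + (\<Sum>u\<in>B. ennreal c)"
      using assms by (simp add: ennreal_plus ennreal_mult ennreal_of_nat_eq_real_of_nat mult.commute)
    also have "\<dots> \<le> (\<Sum>u\<in>A. f u) + (\<Sum>u\<in>B. f u)"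
      by (intro add_mono sum_mono) (auto simp: A_def B_def)
    also have "\<dots> = (\<Sum>u\<in>A \<union> B. f u)"
      using fin AB by (simp add: sum.union_disjoint)
    also have "\<dots> \<le> weight (graph_of n X) f"
      unfolding weight_def verts_graph_of using AB by (intro sum_mono2) auto
    finally show ?thesis .
  qed
  ultimately show ?thesis
    using that AB f(2) by simp
qed

theorem theorem3p1:
  fixes s t :: int and p :: real
  assumes "1 \<le> s" and "s \<le> t - 1"
    and "0 < p" and "p < 1"
  shows "(\<lambda>n. measure_pmf.prob (random_graph n p)
            {G. enn2ereal (sd_number (ennreal (of_int s / of_int t)) G) \<in>
                  {ereal (floor_frac t (a_val p n) + 1 / of_int t) .. ereal (of_int (b_val p t n))}})
         \<longlonglongrightarrow> 1"
proof -
  define c where "c = real_of_int s / real_of_int t"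
  define \<kappa> where "\<kappa> n = nat (b_val p t n)" for n
  have t: "t > 0" "real_of_int t > 0" and c: "0 < c" "c < 1"
    using assms by (auto simp: c_def)
  \<comment> \<open>The lower end of the interval is the least multiple of \<open>1 / t\<close>
    strictly above \<open>a\<close>.\<close>
  have ff: "floor_frac t a + 1 / of_int t = of_int (\<lfloor>of_int t * a\<rfloor> + 1) / of_int t" for a
    using floor_frac_altdef[OF t(1)] by (simp add: add_divide_distrib)
  have b_bounds: "a_val p n + 1 / of_int t \<le> of_int (b_val p t n)" "of_int (b_val p t n) \<le> a_val p n + 2" for n
  proof -
    define m where "m = \<lfloor>of_int t * a_val p n\<rfloor>"
    have b: "b_val p t n = \<lfloor>of_int (m + 1) / real_of_int t\<rfloor> + 1"
      by (simp only: b_val_def ff m_def)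
    have "of_int (m + 1) / real_of_int t < of_int (b_val p t n)"
      unfolding b by (simp only: floor_less_iff[symmetric])
    then have "real_of_int (m + 1) < of_int (t * b_val p t n)"
      using t by (simp only: pos_divide_less_eq of_int_mult mult.commute)
    \<comment> \<open>Both sides are integers, so the strict inequality gains a full unit. As
      \<open>t * a_val p n < m + 1\<close>, this unit is the margin \<open>1 / t\<close> that serves
      as \<open>\<delta>\<close>.\<close>
    then have "m + 2 \<le> t * b_val p t n"
      by (simp only: of_int_less_iff)
    then have "real_of_int (m + 2) \<le> of_int (t * b_val p t n)"
      by (simp only: of_int_le_iff)
    moreover have "of_int t * a_val p n < m + 1"
      by (simp add: m_def)
    ultimately have "of_int t * a_val p n + 1 \<le> of_int t * of_int (b_val p t n)"
      by simp
    then show "a_val p n + 1 / of_int t \<le> of_int (b_val p t n)"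
      using t by (simp add: field_simps)
    have "of_int (b_val p t n) \<le> of_int (m + 1) / real_of_int t + 1"
      unfolding b by simp
    moreover have "of_int m / real_of_int t \<le> a_val p n"
      using t by (simp add: m_def pos_divide_le_eq mult.commute)
    moreover have "1 / real_of_int t \<le> 1"
      using t by simp
    ultimately show "of_int (b_val p t n) \<le> a_val p n + 2"
      by (simp add: add_divide_distrib)
  qed
  \<comment> \<open>Positivity ensures that \<open>nat\<close> does not truncate
    \<open>b_val p t n\<close> in \<open>\<kappa> n\<close>.\<close>
  have a_pos: "eventually (\<lambda>n. a_val p n > 0) sequentially"
  proof -
    have "- ln (1 - p) > 0" using assms by simp
    then show ?thesis
      unfolding a_val_eq[OF assms(3,4)] by real_asymp
  qed
  then have \<kappa>_eq: "eventually (\<lambda>n. real (\<kappa> n) = of_int (b_val p t n)) sequentially"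
  proof eventually_elim
    case (elim n)
    have "1 / real_of_int t > 0" using t by simp
    then have "real_of_int (b_val p t n) > 0"
      using elim b_bounds(1)[of n] by linarith
    then show ?case by (simp add: \<kappa>_def)
  qed

  \<comment> \<open>The two exceptional events and the limit\<close>
  define L where "L n = {X. \<exists>A B. A \<subseteq> {1..n} \<and> B \<subseteq> {1..n} \<and> A \<inter> B = {} \<and>
    real (card A) + c * real (card B) \<le> a_val p n \<and> dominates X A ({1..n} - A - B)}" for n
  define U where "U n = {X. \<forall>S. S \<subseteq> {1..n} \<and> card S = \<kappa> n \<longrightarrow> \<not> dominates X S ({1..n} - S)}" for n
  let ?P = "\<lambda>n. measure_pmf.prob (edge_pmf n p)"
  let ?I = "\<lambda>n. {ereal (floor_frac t (a_val p n) + 1 / of_int t) .. ereal (of_int (b_val p t n))}"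
  let ?good = "\<lambda>n. {X. enn2ereal (sd_number (ennreal c) (graph_of n X)) \<in> ?I n}"
  have "(\<lambda>n. ?P n (L n)) \<longlonglongrightarrow> 0"
    unfolding L_def by (rule prob_light_dominating_tendsto_0[OF assms(3,4) c])
  moreover have "(\<lambda>n. ?P n (U n)) \<longlonglongrightarrow> 0"
    unfolding U_def
  proof (rule prob_no_dominating_set_tendsto_0[OF assms(3,4)])
    show "eventually (\<lambda>n. a_val p n + 1 / of_int t \<le> \<kappa> n \<and> \<kappa> n \<le> a_val p n + 2) sequentially"
      using \<kappa>_eq by eventually_elim (use b_bounds in simp)
  qed (use t in simp)
  ultimately have "(\<lambda>n. 1 - (?P n (L n) + ?P n (U n))) \<longlonglongrightarrow> 1 - (0 + 0)"
    by (intro tendsto_intros)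
  then have lim: "(\<lambda>n. 1 - (?P n (L n) + ?P n (U n))) \<longlonglongrightarrow> 1"
    by simp
  have "(\<lambda>n. ?P n (?good n)) \<longlonglongrightarrow> 1"
  proof (rule tendsto_sandwich[OF _ _ lim tendsto_const])
    show "eventually (\<lambda>n. 1 - (?P n (L n) + ?P n (U n)) \<le> ?P n (?good n)) sequentially"
      using \<kappa>_eq
    proof eventually_elim
      case (elim n)
      have "X \<in> ?good n" if X: "X \<notin> L n" "X \<notin> U n" for X
      proof -
        let ?sd = "sd_number (ennreal c) (graph_of n X)"
        obtain A B where AB: "A \<subseteq> {1..n}" "B \<subseteq> {1..n}" "A \<inter> B = {}" "dominates X A ({1..n} - A - B)"
          "ennreal (real (card A) + c * real (card B)) \<le> ?sd"
          using sd_number_graph_ofE[of c n X] c by auto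
        \<comment> \<open>The bound \<open>|A| + c * |B|\<close> is \<open>N / t\<close> with an
          integer \<open>N\<close>; being strictly above \<open>a_val p n\<close>, it is at least
          the next multiple of \<open>1 / t\<close>.\<close>
        define N where "N = t * int (card A) + s * int (card B)"
        have N: "real (card A) + c * real (card B) = of_int N / of_int t"
          using t by (simp add: N_def c_def add_divide_distrib)
        have "a_val p n < real (card A) + c * real (card B)"
        proof (rule ccontr)
          assume "\<not> a_val p n < real (card A) + c * real (card B)"
          then have "X \<in> L n"
            unfolding L_def using AB(1-4) by (intro CollectI exI[of _ A] exI[of _ B] conjI) simp_all
          then show False using X(1) by simp
        qed
        then have "of_int t * a_val p n < of_int N"
          using t by (simp add: N pos_less_divide_eq mult.commute)
        then have "\<lfloor>of_int t * a_val p n\<rfloor> + 1 \<le> N"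
          by (simp add: floor_less_iff add1_zle_eq)
        then have "floor_frac t (a_val p n) + 1 / of_int t \<le> of_int N / of_int t"
          unfolding ff using t by (intro divide_right_mono) (simp_all only: of_int_le_iff less_imp_le)
        then have "ereal (floor_frac t (a_val p n) + 1 / of_int t) \<le>
            enn2ereal (ennreal (real (card A) + c * real (card B)))"
          using c by (subst enn2ereal_ennreal) (simp_all add: N[symmetric])
        also have "\<dots> \<le> enn2ereal ?sd"
          using AB(5) by (simp add: less_eq_ennreal.rep_eq)
        finally have lower: "ereal (floor_frac t (a_val p n) + 1 / of_int t) \<le> enn2ereal ?sd" .
        obtain S where S: "S \<subseteq> {1..n}" "card S = \<kappa> n" "dominates X S ({1..n} - S)"
          using X(2) by (auto simp: U_def)
        have "ennreal c \<le> 1"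
          using c by simp
        then have "?sd \<le> ennreal (real (\<kappa> n))"
          using sd_number_le_card[OF S(1,3)] S(2) by (simp add: ennreal_of_nat_eq_real_of_nat)
        then have "enn2ereal ?sd \<le> enn2ereal (ennreal (real (\<kappa> n)))"
          by (simp only: less_eq_ennreal.rep_eq)
        then have "enn2ereal ?sd \<le> ereal (of_int (b_val p t n))"
          by (simp add: enn2ereal_ennreal elim[symmetric])
        with lower show ?thesis by simp
      qed
      then have "UNIV \<subseteq> L n \<union> U n \<union> ?good n"
        by blast
      then have "?P n UNIV \<le> ?P n (L n \<union> U n \<union> ?good n)"
        by (intro measure_pmf.finite_measure_mono) auto
      also have "\<dots> \<le> ?P n (L n \<union> U n) + ?P n (?good n)"
        by (rule measure_Un_le) simp_all
      also have "?P n (L n \<union> U n) \<le> ?P n (L n) + ?P n (U n)"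
        by (rule measure_Un_le) simp_all
      finally show ?case
        by simp
    qed
  qed simp
  moreover have "random_graph n p = map_pmf (graph_of n) (edge_pmf n p)" for n
    by (simp add: random_graph_def edge_pmf_def graph_of_def[abs_def])
  ultimately show ?thesis
    by (simp add: c_def measure_map_pmf vimage_def)
qed

end
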